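(* Let $n$ and $m$ be positive odd integers, let $\alpha,\beta$ be real numbers with $\alpha>0$ and $\alpha\beta=1$, and let $\theta,\varphi\in(0,\pi/2)$. Define $s(x)=1$ for $x\ge 0$ and $s(x)=-1$ for $x<0$. Then $$\sum_{|j|\le\frac{n-1}{2}}s(j)\arctan\frac{\sin 2\theta}{\left(\frac{\alpha+\tan\frac{\varphi+\pi j}{n}}{\alpha-\tan\frac{\varphi+\pi j}{n}}\right)^{m\,s(j)}-\cos 2\theta}+\sum_{|k|\le\frac{m-1}{2}}s(k)\arctan\frac{\sin 2\varphi}{\left(\frac{\beta+\tan\frac{\theta+\pi k}{m}}{\beta-\tan\frac{\theta+\pi k}{m}}\right)^{n\,s(k)}-\cos 2\varphi}=\frac{\pi}{2}-\theta-\varphi.$$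
   Context: $\sum_{|j|\le N}$ denotes the sum over all integers $j$ with $-N\le j\le N$. $\arctan$ is the principal value, in $(-\pi/2,\pi/2)$. Convention: if for some index the power $\left(\frac{\alpha+\tan\frac{\varphi+\pi j}{n}}{\alpha-\tan\frac{\varphi+\pi j}{n}}\right)^{m\,s(j)}$ (or the analogous power in the second sum) is infinite, i.e. $\alpha=s(j)\tan\frac{\varphi+\pi j}{n}$ (respectively $\beta=s(k)\tan\frac{\theta+\pi k}{m}$), the corresponding $\arctan$ is interpreted as its limiting value $0$. *)

theory Defs
  imports Complex_Main
begin

definition s :: "int \<Rightarrow> int" where
  "s j = (if j \<ge> 0 then 1 else - 1)"

(* The first branch is the limiting value of the arctan when the power is infinite; it is
   needed because in HOL both x / 0 and 0 powi (negative) are 0.  The other denominator,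
   power - cos (2 * \<theta>), does not vanish in the range of parameters used:
   there s j * tan (...) > 0, so the power has absolute value > 1. *)
definition arctan_term :: "nat \<Rightarrow> nat \<Rightarrow> real \<Rightarrow> real \<Rightarrow> real \<Rightarrow> int \<Rightarrow> real" where
  "arctan_term n m \<alpha> \<phi> \<theta> j =
     (let t = tan ((\<phi> + pi * of_int j) / real n)
      in if \<alpha> = of_int (s j) * t then 0
         else arctan (sin (2 * \<theta>) /
                (((\<alpha> + t) / (\<alpha> - t)) powi (int m * s j) - cos (2 * \<theta>))))"

end

theory Submission
  imports Defs "HOL-Analysis.Complex_Transcendental"
begin

text \<open>
  Write \<open>t\<^sub>j = tan ((\<phi> + \<pi>j)/n)\<close>, \<open>\<psi>\<^sub>k = (\<theta> + \<pi>k)/m\<close> and \<open>\<tau>\<^sub>k = tan \<psi>\<^sub>k\<close>. The identity is a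
  reciprocity law: both sums expand into double sums over the same pairs \<open>(j, k)\<close>, and the
  two summands belonging to a pair are arctangents of reciprocal numbers.

  To expand the first sum, put \<open>u = s(j) t\<^sub>j > 0\<close> and \<open>z = (\<alpha> - u)/(\<alpha> + u)\<close>, so that \<open>|z| < 1\<close>. The
  \<open>j\<close>-th arctangent is \<open>- Im Ln (1 - z\<^sup>m cis (2\<theta>))\<close>, and this also covers the infinite power, where
  \<open>z = 0\<close>. Since \<open>1 - z\<^sup>m cis (2\<theta>)\<close> is the product of the factors \<open>1 - z cis (2\<psi>\<^sub>k)\<close>, its
  argument is the sum of the arguments of the factors (\<open>arctan_power_distribution\<close>). Each factor
  contributes \<open>arctan (\<alpha>\<tau>\<^sub>k/u) - \<psi>\<^sub>k\<close> (\<open>arctan_mult_tan\<close>), and the angles \<open>\<psi>\<^sub>k\<close> add up to \<open>\<theta>\<close>. As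
  the signs \<open>s(j)\<close> add up to 1, the first sum is the double sum of \<open>arctan (\<alpha>\<tau>\<^sub>k/t\<^sub>j)\<close> minus \<open>\<theta>\<close>
  (\<open>arctan_term_expansion\<close>).

  By symmetry and \<open>\<beta> = 1/\<alpha>\<close>, the second sum is the double sum of \<open>arctan (t\<^sub>j/(\<alpha>\<tau>\<^sub>k))\<close> minus \<open>\<phi>\<close>.
  Each pair then contributes \<open>arctan x + arctan (1/x) = sgn x \<cdot> \<pi>/2\<close> with \<open>sgn x = s(j) s(k)\<close>, and the
  product of the two sign sums is 1.
\<close>

section \<open>Distributing the arctangent over the roots\<close>

text \<open>
  Both sides are \<open>- Im Ln (1 - w cis x)\<close>. The number \<open>1 - w cis x\<close> lies in the right half-plane, so its
  principal argument is the arctangent of the quotient of its imaginary and real parts.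
\<close>
lemma sums_power_sin_arctan:
  fixes w x :: real
  assumes "\<bar>w\<bar> < 1"
  shows "(\<lambda>r. w ^ r * sin (real r * x) / real r) sums arctan (w * sin x / (1 - w * cos x))"
proof -
  define z where "z = of_real w * cis x"
  have "cmod z < 1"
    using assms by (simp add: z_def norm_mult)
  then have "(\<lambda>r. - ((-(- z)) ^ r) / of_nat r) sums Ln (1 + (- z))"
    by (intro Ln_series') simp
  then have "(\<lambda>r. Im (z ^ r / of_nat r)) sums - Im (Ln (1 - z))"
    using sums_minus[OF sums_Im] by fastforce
  moreover have "Im (z ^ r / of_nat r) = w ^ r * sin (real r * x) / real r" for r
    by (simp add: z_def power_mult_distrib Complex.DeMoivre flip: of_real_power)
  moreover have "- Im (Ln (1 - z)) = arctan (w * sin x / (1 - w * cos x))"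
  proof -
    have "\<bar>Re z\<bar> < 1"
      using abs_Re_le_cmod[of z] \<open>cmod z < 1\<close> by linarith
    then have pos: "Re (1 - z) > 0"
      by simp
    have "arctan (Im (1 - z) / Re (1 - z)) = Im (Ln (1 - z))"
    proof (rule arctan_unique)
      have ln: "\<bar>Im (Ln (1 - z))\<bar> < pi / 2"
        using Re_Ln_pos_lt_imp[OF pos] .
      show "- (pi / 2) < Im (Ln (1 - z))" "Im (Ln (1 - z)) < pi / 2"
        using ln by linarith+
      have "1 - z = exp (Ln (1 - z))"
        using pos by (intro exp_Ln[symmetric]) auto
      then have "Re (1 - z) = exp (Re (Ln (1 - z))) * cos (Im (Ln (1 - z)))"
        "Im (1 - z) = exp (Re (Ln (1 - z))) * sin (Im (Ln (1 - z)))"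
        by (metis Re_exp, metis Im_exp)
      then show "tan (Im (Ln (1 - z))) = Im (1 - z) / Re (1 - z)"
        by (simp only: tan_def) simp
    qed
    moreover have "Im (1 - z) / Re (1 - z) = - (w * sin x / (1 - w * cos x))"
      by (simp add: z_def)
    ultimately show ?thesis
      by (simp add: arctan_minus)
  qed
  ultimately show ?thesis
    by (simp only:)
qed

text \<open>
  Stepping \<open>k\<close> by one multiplies \<open>cis (r(x + 2\<pi>k)/m)\<close> by an \<open>m\<close>-th root of unity, which is 1 exactly
  when \<open>m\<close> divides \<open>r\<close>; otherwise the geometric sum over a full period vanishes.
\<close>
lemma sum_sin_equidistant:
  fixes x :: real and m r :: nat and a :: int
  assumes "m > 0"
  shows "(\<Sum>k\<in>{a..<a + int m}. sin (real r * ((x + 2 * pi * of_int k) / real m)))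
       = (if m dvd r then real m * sin (real (r div m) * x) else 0)"
proof (cases "m dvd r")
  case True
  then obtain q where q: "r = m * q" ..
  have "sin (real r * ((x + 2 * pi * of_int k) / real m)) = sin (real q * x)" for k :: int
  proof -
    have "real r * ((x + 2 * pi * of_int k) / real m) = real q * x + 2 * pi * of_int (int q * k)"
      using assms by (simp add: q field_simps)
    moreover have "sin (real q * x + 2 * pi * of_int (int q * k)) = sin (real q * x)"
      unfolding sin_add sin_int_2pin cos_int_2pin by simp
    ultimately show ?thesis
      by (simp only:)
  qed
  then show ?thesis
    using assms by (simp add: q)
next
  case False
  define \<zeta> where "\<zeta> = cis (2 * pi * real r / real m)"
  define c where "c = cis (real r * ((x + 2 * pi * of_int a) / real m))"
  have "\<zeta> \<noteq> 1"
  proof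
    assume "\<zeta> = 1"
    then have "cos (2 * pi * real r / real m) = 1"
      by (simp add: \<zeta>_def complex_eq_iff)
    then obtain i :: int where "2 * pi * real r / real m = of_int i * (2 * pi)"
      by (auto simp: cos_one_2pi_int mult_ac)
    then have "real r = of_int i * real m"
      using assms by (simp add: field_simps)
    then have "int r = i * int m"
      by (metis of_int_eq_iff of_int_mult of_int_of_nat_eq)
    then show False
      using False by (metis dvd_triv_right int_dvd_int_iff)
  qed
  moreover have "\<zeta> ^ m = 1"
  proof -
    have "\<zeta> ^ m = cis (2 * pi * real r)"
      using assms by (simp add: \<zeta>_def Complex.DeMoivre)
    then show ?thesis
      by (simp add: complex_eq_iff)
  qed
  ultimately have geo: "(\<Sum>i<m. \<zeta> ^ i) = 0"
    by (simp add: geometric_sum)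
  have "(\<Sum>k\<in>{a..<a + int m}. cis (real r * ((x + 2 * pi * of_int k) / real m)))
      = (\<Sum>i<m. cis (real r * ((x + 2 * pi * of_int (a + int i)) / real m)))"
    by (rule sum.reindex_bij_witness[of _ "\<lambda>i. a + int i" "\<lambda>k. nat (k - a)"]) auto
  also have "\<dots> = (\<Sum>i<m. c * \<zeta> ^ i)"
    unfolding c_def \<zeta>_def
    by (intro sum.cong refl)
      (use assms in \<open>simp add: Complex.DeMoivre cis_mult field_simps\<close>)
  also have "\<dots> = 0"
    using geo by (simp flip: sum_distrib_left)
  finally have "Im (\<Sum>k\<in>{a..<a + int m}. cis (real r * ((x + 2 * pi * of_int k) / real m))) = 0"
    by simp
  then show ?thesis
    using False by simp
qed

text \<open>
  This is the argument of the factorisation of \<open>1 - z\<^sup>m cis x\<close>. Comparing power series in \<open>z\<close> avoids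
  any discussion of branches: when the series of the summands on the right are added, only the
  coefficients at the multiples of \<open>m\<close> survive, and these form the series of the left-hand side.
\<close>
lemma arctan_power_distribution:
  fixes z x :: real and m :: nat and a :: int
  assumes "\<bar>z\<bar> < 1" and "m > 0"
  shows "arctan (z ^ m * sin x / (1 - z ^ m * cos x))
       = (\<Sum>k\<in>{a..<a + int m}. arctan (z * sin ((x + 2 * pi * of_int k) / real m)
                                     / (1 - z * cos ((x + 2 * pi * of_int k) / real m))))"
    (is "_ = ?R")
proof -
  let ?f = "\<lambda>r. \<Sum>k\<in>{a..<a + int m}. z ^ r * sin (real r * ((x + 2 * pi * of_int k) / real m)) / real r"
  have f: "?f r = (if m dvd r then z ^ r * (real m * sin (real (r div m) * x)) / real r else 0)" for r
    using sum_sin_equidistant[OF assms(2), of r x a]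
    by (auto simp flip: sum_distrib_left sum_divide_distrib)
  have "?f sums ?R"
    by (intro sums_sum sums_power_sin_arctan assms)
  moreover have "strict_mono (\<lambda>q. m * q)"
    using assms by (auto intro: strict_monoI)
  moreover have "?f r = 0" if "r \<notin> range (\<lambda>q. m * q)" for r
    unfolding f using that by (auto simp: dvd_def)
  ultimately have "(\<lambda>q. ?f (m * q)) sums ?R"
    using sums_mono_reindex[of "\<lambda>q. m * q" ?f ?R] by blast
  moreover have "?f (m * q) = (z ^ m) ^ q * sin (real q * x) / real q" for q
    unfolding f using assms by (simp add: power_mult)
  ultimately have "(\<lambda>q. (z ^ m) ^ q * sin (real q * x) / real q) sums ?R"
    by simp
  moreover have "\<bar>z ^ m\<bar> < 1"
    using assms by (simp add: power_abs power_less_one_iff)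
  ultimately show ?thesis
    using sums_power_sin_arctan[of "z ^ m" x] sums_unique2 by blast
qed

text \<open>
  The tangents of both sides agree by the addition theorem. No multiple of \<open>\<pi>\<close> is lost, because
  \<open>arctan (c tan \<psi>)\<close> and \<open>\<psi>\<close> have the same sign, which keeps their difference within
  \<open>(-\<pi>/2, \<pi>/2)\<close>.
\<close>
lemma arctan_mult_tan:
  fixes c \<psi> :: real
  assumes "c > 0" and \<psi>: "\<bar>\<psi>\<bar> < pi / 2"
  shows "arctan ((c - 1) / (c + 1) * sin (2 * \<psi>) / (1 - (c - 1) / (c + 1) * cos (2 * \<psi>)))
       = arctan (c * tan \<psi>) - \<psi>"
proof (rule arctan_unique)
  have cos: "cos \<psi> > 0"
    using \<psi> by (intro cos_gt_zero_pi) auto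
  let ?a = "arctan (c * tan \<psi>)"
  have "\<psi> \<ge> 0 \<Longrightarrow> ?a \<ge> 0" "\<psi> \<le> 0 \<Longrightarrow> ?a \<le> 0"
    using assms tan_pos_pi2_le[of \<psi>] tan_pos_pi2_le[of "- \<psi>"]
    by (auto simp: zero_le_mult_iff mult_le_0_iff)
  then show bounds: "- (pi / 2) < ?a - \<psi>" "?a - \<psi> < pi / 2"
    using \<psi> arctan_lbound[of "c * tan \<psi>"] arctan_ubound[of "c * tan \<psi>"] by linarith+
  have "cos (?a - \<psi>) \<noteq> 0"
    using bounds cos_gt_zero_pi[of "?a - \<psi>"] by auto
  then have "tan (?a - \<psi>) = (c * tan \<psi> - tan \<psi>) / (1 + c * tan \<psi> * tan \<psi>)"
    using cos by (subst tan_diff) (auto simp: tan_arctan)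
  also have "\<dots> = (c - 1) * (2 * sin \<psi> * cos \<psi>) / (2 * ((cos \<psi>)\<^sup>2 + c * (sin \<psi>)\<^sup>2))"
  proof -
    have half: "(c - 1) * (2 * sin \<psi> * cos \<psi>) = 2 * ((c - 1) * (sin \<psi> * cos \<psi>))"
      by simp
    have "(cos \<psi>)\<^sup>2 + c * (sin \<psi>)\<^sup>2 > 0"
      using cos \<open>c > 0\<close> by (intro add_pos_nonneg) auto
    moreover have "1 + c * tan \<psi> * tan \<psi> = ((cos \<psi>)\<^sup>2 + c * (sin \<psi>)\<^sup>2) / (cos \<psi>)\<^sup>2"
      using cos by (simp add: tan_def field_simps power2_eq_square)
    moreover have "c * tan \<psi> - tan \<psi> = (c - 1) * (sin \<psi> * cos \<psi>) / (cos \<psi>)\<^sup>2"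
      using cos by (simp add: tan_def field_simps power2_eq_square)
    ultimately show ?thesis
      unfolding half mult_divide_mult_cancel_left_if using cos by simp
  qed
  also have "2 * ((cos \<psi>)\<^sup>2 + c * (sin \<psi>)\<^sup>2) = (c + 1) - (c - 1) * cos (2 * \<psi>)"
    unfolding cos_double using sin_cos_squared_add[of \<psi>] by algebra
  also have "(c - 1) * (2 * sin \<psi> * cos \<psi>) / ((c + 1) - (c - 1) * cos (2 * \<psi>))
      = (c - 1) / (c + 1) * sin (2 * \<psi>) / (1 - (c - 1) / (c + 1) * cos (2 * \<psi>))"
  proof -
    have "(c + 1) - (c - 1) * cos (2 * \<psi>) = (c + 1) * (1 - (c - 1) / (c + 1) * cos (2 * \<psi>))"
      using \<open>c > 0\<close> by (simp add: field_simps)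
    then show ?thesis
      using \<open>c > 0\<close> by (simp add: sin_double)
  qed
  finally show "tan (?a - \<psi>) = \<dots>" .
qed

section \<open>Sums over the symmetric index range\<close>

abbreviation symmetric_range :: "nat \<Rightarrow> int set" where
  "symmetric_range m \<equiv> {- ((int m - 1) div 2)..(int m - 1) div 2}"

lemma abs_symmetric_range:
  fixes k :: int
  assumes "k \<in> symmetric_range m"
  shows "2 * \<bar>real_of_int k\<bar> \<le> real m - 1"
proof -
  have "2 * \<bar>k\<bar> \<le> int m - 1"
    using assms by auto
  then have "real_of_int (2 * \<bar>k\<bar>) \<le> real_of_int (int m - 1)"
    by (rule of_int_le_iff[THEN iffD2])
  then show ?thesis by simp
qed

lemma symmetric_range_eq:
  assumes "odd m"
  shows "symmetric_range m = {- ((int m - 1) div 2)..<- ((int m - 1) div 2) + int m}"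
  using assms by (auto elim!: oddE)

text \<open>
  Index 0 counts as positive; all others cancel in pairs \<open>\<plusminus>k\<close>.
\<close>
lemma sum_s_symmetric_range:
  assumes "odd m"
  shows "(\<Sum>k\<in>symmetric_range m. real_of_int (s k)) = 1"
proof -
  define h where "h = (int m - 1) div 2"
  have "h \<ge> 0"
    using assms by (auto simp: h_def elim!: oddE)
  then have "{- h..h} = {0..h} \<union> {- h..<0}"
    by auto
  moreover have "{0..h} \<inter> {- h..<0} = {}"
    by auto
  ultimately have "(\<Sum>k\<in>{- h..h}. real_of_int (s k))
      = (\<Sum>k\<in>{0..h}. real_of_int (s k)) + (\<Sum>k\<in>{- h..<0}. real_of_int (s k))"
    by (metis finite_atLeastAtMost_int finite_atLeastLessThan_int sum.union_disjoint)
  also have "\<dots> = 1"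
    using \<open>h \<ge> 0\<close> by (simp add: s_def)
  finally show ?thesis
    by (simp add: h_def)
qed

lemma sum_shifted_angles:
  fixes \<theta> :: real
  assumes "odd m"
  shows "(\<Sum>k\<in>symmetric_range m. (\<theta> + pi * of_int k) / real m) = \<theta>"
proof -
  have "(\<Sum>k\<in>symmetric_range m. real_of_int k) = (\<Sum>k\<in>symmetric_range m. real_of_int (- k))"
    by (rule sum.reindex_bij_witness[of _ uminus uminus]) auto
  then have "(\<Sum>k\<in>symmetric_range m. real_of_int k) = 0"
    by (simp add: sum_negf)
  moreover have "card (symmetric_range m) = m"
    unfolding symmetric_range_eq[OF assms] by simp
  ultimately show ?thesis
    using odd_pos[OF assms] by (simp add: sum.distrib flip: sum_divide_distrib sum_distrib_left)
qed

text \<open>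
  Since \<open>0 < \<theta> < \<pi>/2\<close> and \<open>|k| \<le> (m - 1)/2\<close>, the angle \<open>\<theta> + \<pi>k\<close> is smaller than \<open>m\<pi>/2\<close> in absolute
  value, and it is positive exactly when \<open>k \<ge> 0\<close>. This is why the sign function \<open>s\<close> counts 0 as
  positive.
\<close>
lemma shifted_angle:
  fixes \<theta> :: real
  assumes \<theta>: "\<theta> \<in> {0<..<pi / 2}" and k: "k \<in> symmetric_range m"
  defines "\<psi> \<equiv> (\<theta> + pi * of_int k) / real m"
  shows "\<bar>\<psi>\<bar> < pi / 2" and "sgn (tan \<psi>) = of_int (s k)"
proof -
  have "m > 0"
    using abs_symmetric_range[OF k] by (cases "m = 0") auto
  have "pi * (2 * \<bar>of_int k\<bar>) \<le> pi * (real m - 1)"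
    using abs_symmetric_range[OF k] by (intro mult_left_mono) auto
  then have "\<bar>pi * of_int k\<bar> \<le> pi * (real m - 1) / 2"
    by (simp add: abs_mult)
  then have "\<bar>\<theta> + pi * of_int k\<bar> < pi / 2 * real m"
    using \<theta> by (auto simp: algebra_simps abs_if split: if_splits)
  then show bound: "\<bar>\<psi>\<bar> < pi / 2"
    using \<open>m > 0\<close> by (simp add: \<psi>_def abs_divide field_simps)
  show "sgn (tan \<psi>) = of_int (s k)"
  proof (cases "k \<ge> 0")
    case True
    then have "\<psi> > 0"
      using \<theta> \<open>m > 0\<close> by (simp add: \<psi>_def add_pos_nonneg)
    then show ?thesis
      using bound True tan_gt_zero[of \<psi>] by (simp add: s_def)
  next
    case False
    then have "pi * of_int k \<le> pi * (- 1)"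
      by (intro mult_left_mono) auto
    then have "\<theta> + pi * of_int k < 0"
      using \<theta> by auto
    then have "\<psi> < 0"
      using \<open>m > 0\<close> by (simp add: \<psi>_def divide_neg_pos)
    then show ?thesis
      using bound False tan_less_zero[of \<psi>] by (simp add: s_def)
  qed
qed

section \<open>The reciprocity\<close>

text \<open>
  The exponent \<open>m s(j)\<close> serves to make the power the reciprocal of \<open>z\<^sup>m\<close> with \<open>|z| < 1\<close> for either sign of
  \<open>t\<^sub>j\<close>, so that the argument of \<open>1 - z\<^sup>m cis (2\<theta>)\<close> distributes over its factors. The weight \<open>s(j)\<close> then
  restores the sign of \<open>t\<^sub>j\<close> inside each arctangent.
\<close>
lemma arctan_term_expansion:
  fixes n m :: nat and \<alpha> \<theta> \<phi> :: real and j :: int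
  assumes "odd m" and "\<alpha> > 0"
    and \<theta>: "\<theta> \<in> {0<..<pi / 2}" and \<phi>: "\<phi> \<in> {0<..<pi / 2}"
    and j: "j \<in> symmetric_range n"
  shows "of_int (s j) * arctan_term n m \<alpha> \<phi> \<theta> j
       = (\<Sum>k\<in>symmetric_range m. arctan (\<alpha> * tan ((\<theta> + pi * of_int k) / real m)
                                        / tan ((\<phi> + pi * of_int j) / real n)))
         - of_int (s j) * \<theta>"
proof -
  define t where "t = tan ((\<phi> + pi * of_int j) / real n)"
  define u where "u = of_int (s j) * t"
  define z where "z = (\<alpha> - u) / (\<alpha> + u)"
  define \<psi> where "\<psi> = (\<lambda>k::int. (\<theta> + pi * of_int k) / real m)"
  have sgn: "sgn t = of_int (s j)"
    using shifted_angle(2)[OF \<phi> j] by (simp add: t_def)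
  have s_cases: "s j = 1 \<or> s j = - 1"
    by (simp add: s_def)
  have "u > 0"
    using s_cases
  proof
    assume "s j = 1"
    then show ?thesis
      using sgn by (simp add: u_def sgn_1_pos)
  next
    assume "s j = - 1"
    then show ?thesis
      using sgn by (simp add: u_def sgn_1_neg)
  qed
  have "m > 0"
    using \<open>odd m\<close> by (rule odd_pos)
  have z: "\<bar>z\<bar> < 1"
    using \<open>u > 0\<close> \<open>\<alpha> > 0\<close> by (auto simp: z_def abs_less_iff field_simps)
  have closed: "arctan_term n m \<alpha> \<phi> \<theta> j = arctan (z ^ m * sin (2 * \<theta>) / (1 - z ^ m * cos (2 * \<theta>)))"
    \<comment> \<open>The default value 0 agrees with the right-hand side, since \<open>z = 0\<close> when \<open>\<alpha> = u\<close>.\<close>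
  proof (cases "\<alpha> = u")
    case True
    then show ?thesis
      using \<open>m > 0\<close> by (simp add: arctan_term_def z_def u_def t_def)
  next
    case False
    have "z \<noteq> 0"
      using False \<open>u > 0\<close> \<open>\<alpha> > 0\<close> by (simp add: z_def)
    have "((\<alpha> + t) / (\<alpha> - t)) powi (int m * s j) = inverse (z ^ m)"
      using s_cases
      by (auto simp: z_def u_def power_int_minus power_divide simp flip: power_inverse)
    then have "arctan_term n m \<alpha> \<phi> \<theta> j = arctan (sin (2 * \<theta>) / (inverse (z ^ m) - cos (2 * \<theta>)))"
      using False by (simp add: arctan_term_def u_def t_def Let_def)
    also have "sin (2 * \<theta>) / (inverse (z ^ m) - cos (2 * \<theta>))
        = z ^ m * sin (2 * \<theta>) / (z ^ m * (inverse (z ^ m) - cos (2 * \<theta>)))"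
      using \<open>z \<noteq> 0\<close> by simp
    also have "z ^ m * (inverse (z ^ m) - cos (2 * \<theta>)) = 1 - z ^ m * cos (2 * \<theta>)"
      using \<open>z \<noteq> 0\<close> by (simp add: algebra_simps)
    finally show ?thesis .
  qed
  have angle: "(2 * \<theta> + 2 * pi * of_int k) / real m = 2 * \<psi> k" for k :: int
    by (simp add: \<psi>_def)
  have z_quot: "z = (\<alpha> / u - 1) / (\<alpha> / u + 1)"
  proof -
    have "\<alpha> / u - 1 = (\<alpha> - u) / u" "\<alpha> / u + 1 = (\<alpha> + u) / u"
      using \<open>u > 0\<close> by (simp_all add: field_simps)
    then show ?thesis
      using \<open>u > 0\<close> by (simp add: z_def)
  qed
  have "arctan_term n m \<alpha> \<phi> \<theta> j
      = (\<Sum>k\<in>symmetric_range m. arctan (z * sin (2 * \<psi> k) / (1 - z * cos (2 * \<psi> k))))"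
    unfolding closed arctan_power_distribution[OF z \<open>m > 0\<close>, where a = "- ((int m - 1) div 2)"]
      angle symmetric_range_eq[OF \<open>odd m\<close>] ..
  also have "\<dots> = (\<Sum>k\<in>symmetric_range m. arctan (\<alpha> / u * tan (\<psi> k)) - \<psi> k)"
    unfolding z_quot using \<open>u > 0\<close> \<open>\<alpha> > 0\<close> shifted_angle(1)[OF \<theta>]
    by (intro sum.cong refl arctan_mult_tan) (auto simp: \<psi>_def)
  also have "\<dots> = (\<Sum>k\<in>symmetric_range m. arctan (\<alpha> / u * tan (\<psi> k))) - \<theta>"
    using sum_shifted_angles[OF \<open>odd m\<close>, of \<theta>] by (simp add: sum_subtractf \<psi>_def)
  finally have "of_int (s j) * arctan_term n m \<alpha> \<phi> \<theta> j
      = (\<Sum>k\<in>symmetric_range m. of_int (s j) * arctan (\<alpha> / u * tan (\<psi> k))) - of_int (s j) * \<theta>"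
    by (simp add: right_diff_distrib sum_distrib_left)
  moreover have "of_int (s j) * arctan (\<alpha> / u * tan (\<psi> k)) = arctan (\<alpha> * tan (\<psi> k) / t)" for k
    using s_cases by (auto simp: u_def simp flip: arctan_minus)
  ultimately show ?thesis
    by (simp add: \<psi>_def t_def)
qed

theorem theorem5:
  fixes n m :: nat and \<alpha> \<beta> \<theta> \<phi> :: real
  assumes "n > 0" and "odd n" and "m > 0" and "odd m"
    and "\<alpha> > 0" and "\<alpha> * \<beta> = 1"
    and "\<theta> \<in> {0<..<pi / 2}" and "\<phi> \<in> {0<..<pi / 2}"
  shows "(\<Sum>j\<in>{- ((int n - 1) div 2)..(int n - 1) div 2}. of_int (s j) * arctan_term n m \<alpha> \<phi> \<theta> j)
       + (\<Sum>k\<in>{- ((int m - 1) div 2)..(int m - 1) div 2}. of_int (s k) * arctan_term m n \<beta> \<theta> \<phi> k)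
       = pi / 2 - \<theta> - \<phi>"
proof -
  define t where "t = (\<lambda>j::int. tan ((\<phi> + pi * of_int j) / real n))"
  define \<tau> where "\<tau> = (\<lambda>k::int. tan ((\<theta> + pi * of_int k) / real m))"
  have \<beta>: "\<beta> = 1 / \<alpha>"
    using assms(5,6) by (simp add: field_simps)
  have "\<beta> > 0"
    using assms(5) \<beta> by simp
  have first: "(\<Sum>j\<in>symmetric_range n. of_int (s j) * arctan_term n m \<alpha> \<phi> \<theta> j)
      = (\<Sum>j\<in>symmetric_range n. \<Sum>k\<in>symmetric_range m. arctan (\<alpha> * \<tau> k / t j)) - \<theta>"
    using arctan_term_expansion[OF assms(4,5,7,8)] sum_s_symmetric_range[OF assms(2)]
    by (simp add: t_def \<tau>_def sum_subtractf flip: sum_distrib_right)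
  have "(\<Sum>k\<in>symmetric_range m. of_int (s k) * arctan_term m n \<beta> \<theta> \<phi> k)
      = (\<Sum>k\<in>symmetric_range m. \<Sum>j\<in>symmetric_range n. arctan (\<beta> * t j / \<tau> k)) - \<phi>"
    using arctan_term_expansion[OF assms(2) \<open>\<beta> > 0\<close> assms(8,7)] sum_s_symmetric_range[OF assms(4)]
    by (simp add: t_def \<tau>_def sum_subtractf flip: sum_distrib_right)
  also have "(\<Sum>k\<in>symmetric_range m. \<Sum>j\<in>symmetric_range n. arctan (\<beta> * t j / \<tau> k))
      = (\<Sum>j\<in>symmetric_range n. \<Sum>k\<in>symmetric_range m. arctan (\<beta> * t j / \<tau> k))"
    by (rule sum.swap)
  finally have second: "(\<Sum>k\<in>symmetric_range m. of_int (s k) * arctan_term m n \<beta> \<theta> \<phi> k)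
      = (\<Sum>j\<in>symmetric_range n. \<Sum>k\<in>symmetric_range m. arctan (\<beta> * t j / \<tau> k)) - \<phi>" .
  have pair: "arctan (\<alpha> * \<tau> k / t j) + arctan (\<beta> * t j / \<tau> k)
      = of_int (s j) * (of_int (s k) * (pi / 2))"
    if j: "j \<in> symmetric_range n" and k: "k \<in> symmetric_range m" for j k
  proof -
    have sgn: "sgn (t j) = of_int (s j)" "sgn (\<tau> k) = of_int (s k)"
      using shifted_angle(2)[OF assms(8) j] shifted_angle(2)[OF assms(7) k]
      by (simp_all add: t_def \<tau>_def)
    then have "t j \<noteq> 0" "\<tau> k \<noteq> 0"
      by (auto simp: s_def split: if_splits)
    moreover have "sgn (\<alpha> * \<tau> k / t j) = of_int (s j) * of_int (s k)"
      using sgn assms(5) by (simp add: sgn_mult sgn_divide s_def)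
    moreover have "\<beta> * t j / \<tau> k = 1 / (\<alpha> * \<tau> k / t j)"
      by (simp add: \<beta>)
    moreover have "arctan (1 / (\<alpha> * \<tau> k / t j))
        = sgn (\<alpha> * \<tau> k / t j) * pi / 2 - arctan (\<alpha> * \<tau> k / t j)"
      using calculation(1,2) assms(5) by (intro Transcendental.arctan_inverse) simp
    ultimately show ?thesis
      by simp
  qed
  have "(\<Sum>j\<in>symmetric_range n. \<Sum>k\<in>symmetric_range m. arctan (\<alpha> * \<tau> k / t j))
      + (\<Sum>j\<in>symmetric_range n. \<Sum>k\<in>symmetric_range m. arctan (\<beta> * t j / \<tau> k))
      = (\<Sum>j\<in>symmetric_range n. \<Sum>k\<in>symmetric_range m. of_int (s j) * (of_int (s k) * (pi / 2)))"
    unfolding sum.distrib[symmetric] by (intro sum.cong refl pair)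
  also have "\<dots> = (\<Sum>j\<in>symmetric_range n. of_int (s j)) * ((\<Sum>k\<in>symmetric_range m. of_int (s k)) * (pi / 2))"
    unfolding sum_distrib_right[of _ _ "pi / 2"] sum_product ..
  also have "\<dots> = pi / 2"
    unfolding sum_s_symmetric_range[OF assms(2)] sum_s_symmetric_range[OF assms(4)] by simp
  finally show ?thesis
    using first second by simp
qed

end
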